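(* Let $\tau$ and $\rho$ be primitive aperiodic substitutions of balanced growth (on finite alphabets $A$ and $B$ respectively) whose associated matrices have the same dominant eigenvalue $\lambda > 1$, and let $X_\tau \subset A^{\mathbb{N}}$ and $X_\rho \subset B^{\mathbb{N}}$ be the associated one-sided subshifts. Then there exists a finite set $P$ of block maps from $X_\tau$ to $X_\rho$ such that if $f : X_\tau \to X_\rho$ is a block map, then $f = \sigma^k \circ g$ or $g = \sigma^k \circ f$ for some $g \in P$ and $k \in \mathbb{N}$.
   Context: $\mathbb{N}$ contains $0$. For a finite alphabet $A$, $A^*$ is the set of finite words, $|w|$ is the length of $w$, $|w|_b$ the number of occurrences of the letter $b$ in $w$, and $v \sqsubset w$ means that $v$ is a factor (contiguous subword) of $w$; $x_{[i,j]} = x_i x_{i+1} \cdots x_j$. The shift $\sigma$ on $A^{\mathbb{N}}$ is $\sigma(x)_i = x_{i+1}$. A subshift is a subset $X \subset A^{\mathbb{N}}$ that is closed in the product topology and satisfies $\sigma(X) \subset X$. A block map between subshifts is a continuous map $f : X \to Y$ with $f \circ \sigma = \sigma \circ f$. A substitution on $A$ is a map $\tau : A^* \to A^*$ with $\tau(uv) = \tau(u)\tau(v)$. Its associated matrix is the $|A| \times |A|$ matrix whose $(a,b)$ entry is $|\tau(a)|_b$; its dominant eigenvalue is the Frobenius eigenvalue. The one-sided subshift $X_\tau \subset A^{\mathbb{N}}$ of $\tau$ is the set of $x \in A^{\mathbb{N}}$ all of whose factors are factors of $\tau^n(a)$ for some $a \in A$, $n \in \mathbb{N}$. $\tau$ is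 primitive if for all $a, b \in A$ we have $a \sqsubset \tau^n(b)$ for all large enough $n$; it is aperiodic if $X_\tau$ contains no $\sigma$-periodic point. A primitive aperiodic substitution $\tau$ has balanced growth if there is a real number $Z(\tau)$ such that $\lim_{n} |\tau(x_{[0,n-1]})|/n = Z(\tau)$ for all $x \in X_\tau$, and there is a constant $D$ such that $|\tau(x_{[0,n-1]})| \in [Z(\tau) n - D, Z(\tau) n + D]$ for all $x \in X_\tau$ and $n \in \mathbb{N}$. *)

theory Defs
  imports "HOL-Analysis.Analysis" "HOL-Library.Sublist"
begin

text \<open>
  Alphabets are finite types, finite words are lists, and one-sided infinite words are
  functions on the natural numbers.  \<open>sublist v w\<close> says that \<open>v\<close> is a contiguous
  factor of \<open>w\<close>; the finite factors of \<open>x :: nat \<Rightarrow> 'a\<close> are the lists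
  \<open>map x [i..<j]\<close>.
\<close>

definition shift :: "(nat \<Rightarrow> 'a) \<Rightarrow> (nat \<Rightarrow> 'a)" where
  "shift x = (\<lambda>i. x (Suc i))"

definition sequence_topology :: "(nat \<Rightarrow> 'a) topology" where
  "sequence_topology = product_topology (\<lambda>_. discrete_topology UNIV) UNIV"

definition subshift :: "(nat \<Rightarrow> 'a) set \<Rightarrow> bool" where
  "subshift X \<longleftrightarrow> closedin sequence_topology X \<and> shift ` X \<subseteq> X"

text \<open>
  Block maps are total HOL functions of which only the values on \<open>X\<close> matter;
  \<open>continuous_map\<close> includes that \<open>f\<close> maps \<open>X\<close> into \<open>Y\<close>.
\<close>

definition block_map ::
    "(nat \<Rightarrow> 'a) set \<Rightarrow> (nat \<Rightarrow> 'b) set \<Rightarrow> ((nat \<Rightarrow> 'a) \<Rightarrow> (nat \<Rightarrow> 'b)) \<Rightarrow> bool" where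
  "block_map X Y f \<longleftrightarrow>
     continuous_map (subtopology sequence_topology X) (subtopology sequence_topology Y) f \<and>
     (\<forall>x\<in>X. f (shift x) = shift (f x))"

definition substitution :: "('a list \<Rightarrow> 'a list) \<Rightarrow> bool" where
  "substitution \<tau> \<longleftrightarrow> (\<forall>u v. \<tau> (u @ v) = \<tau> u @ \<tau> v)"

definition subst_matrix :: "('a::finite list \<Rightarrow> 'a list) \<Rightarrow> real ^ 'a ^ 'a" where
  "subst_matrix \<tau> = (\<chi> a b. real (count_list (\<tau> [a]) b))"

definition is_eigenvalue :: "'k::field ^ 'n ^ 'n \<Rightarrow> 'k \<Rightarrow> bool" where
  "is_eigenvalue M \<mu> \<longleftrightarrow> (\<exists>v. v \<noteq> 0 \<and> M *v v = \<mu> *s v)"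

text \<open>
  The Frobenius eigenvalue of a nonnegative matrix: a real eigenvalue that bounds the modulus
  of every complex eigenvalue.  At most one real number has this property.
\<close>

definition dominant_eigenvalue :: "real ^ 'n ^ 'n \<Rightarrow> real \<Rightarrow> bool" where
  "dominant_eigenvalue M r \<longleftrightarrow>
     is_eigenvalue M r \<and>
     (\<forall>\<mu>. is_eigenvalue (map_matrix complex_of_real M) \<mu> \<longrightarrow> cmod \<mu> \<le> r)"

definition subst_shift :: "('a list \<Rightarrow> 'a list) \<Rightarrow> (nat \<Rightarrow> 'a) set" where
  "subst_shift \<tau> = {x. \<forall>i j. \<exists>a n. sublist (map x [i..<j]) ((\<tau> ^^ n) [a])}"

definition primitive :: "('a list \<Rightarrow> 'a list) \<Rightarrow> bool" where
  "primitive \<tau> \<longleftrightarrow> (\<forall>a b. \<forall>\<^sub>F n in sequentially. sublist [a] ((\<tau> ^^ n) [b]))"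

definition aperiodic :: "('a list \<Rightarrow> 'a list) \<Rightarrow> bool" where
  "aperiodic \<tau> \<longleftrightarrow> \<not> (\<exists>x\<in>subst_shift \<tau>. \<exists>p>0. (shift ^^ p) x = x)"

definition balanced_growth :: "('a list \<Rightarrow> 'a list) \<Rightarrow> bool" where
  "balanced_growth \<tau> \<longleftrightarrow>
     (\<exists>Z::real.
        (\<forall>x\<in>subst_shift \<tau>.
           (\<lambda>n. real (length (\<tau> (map x [0..<n]))) / real n) \<longlonglongrightarrow> Z) \<and>
        (\<exists>D::real. \<forall>x\<in>subst_shift \<tau>. \<forall>n.
           real (length (\<tau> (map x [0..<n]))) \<in> {Z * real n - D .. Z * real n + D}))"

lemma subshift_subst_shift: "subshift (subst_shift \<tau>)"
proof -
  let ?L = "{w. \<exists>a n. sublist w ((\<tau> ^^ n) [a])}"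
  have cyl: "closedin sequence_topology {x. map x [i..<j] \<in> L}" for i j and L :: "'a list set"
  proof -
    have "openin sequence_topology {x. map x [i..<j] \<in> M}" for M :: "'a list set"
    proof (subst openin_subopen, intro ballI)
      fix x assume x: "x \<in> {x. map x [i..<j] \<in> M}"
      let ?C = "Pi\<^sub>E UNIV (\<lambda>k. if k \<in> {i..<j} then {x k} else UNIV)"
      have "finite {k. (if k \<in> {i..<j} then {x k} else UNIV) \<noteq> UNIV}"
        by (rule finite_subset[of _ "{i..<j}"]) auto
      then have "openin sequence_topology ?C"
        unfolding sequence_topology_def by (intro product_topology_basis) auto
      moreover have "x \<in> ?C" by auto
      moreover have "?C \<subseteq> {x. map x [i..<j] \<in> M}"
      proof
        fix y assume "y \<in> ?C"
        then have "y k = x k" if "k \<in> {i..<j}" for k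
          using that by (auto simp: PiE_iff split: if_splits)
        then have "map y [i..<j] = map x [i..<j]" by auto
        then show "y \<in> {x. map x [i..<j] \<in> M}" using x by (simp del: map_eq_conv)
      qed
      ultimately show "\<exists>T. openin sequence_topology T \<and> x \<in> T \<and> T \<subseteq> {x. map x [i..<j] \<in> M}"
        by blast
    qed
    from this[of "- L"] show ?thesis
      by (simp add: closedin_def sequence_topology_def Collect_neg_eq[symmetric] Diff_eq)
  qed
  have eq: "subst_shift \<tau> = (\<Inter>i. \<Inter>j. {x. map x [i..<j] \<in> ?L})"
    by (auto simp: subst_shift_def)
  have "closedin sequence_topology (subst_shift \<tau>)"
    unfolding eq by (intro closedin_INT cyl) auto
  moreover have "shift x \<in> subst_shift \<tau>" if "x \<in> subst_shift \<tau>" for x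
  proof -
    have "map (shift x) [i..<j] = map x [Suc i..<Suc j]" for i j
      by (simp add: shift_def map_Suc_upt[symmetric] del: upt_Suc)
    then show ?thesis using that by (auto simp: subst_shift_def simp del: upt_Suc)
  qed
  ultimately show ?thesis by (auto simp: subshift_def)
qed

end

(*
  Any sufficiently large family of block maps contains two that differ by a shift. Take a common
  radius r, a point x, and a power of rho whose images of letters have lengths comparable to some
  s > r. A prefix of f(x) of length O(s) is read off from a word v of bounded length, bounded
  independently of r and s, and an offset j <= s into the image of v. By pigeonhole two maps f, g
  share the same v, so g(x) and the shift of f(x) by k = j_g - j_f <= s agree on a prefix of length
  K (r + s), where K is the linear recurrence constant of tau. That prefix of x contains every
  factor of length r + k, so g = shift^k o f everywhere. A maximal family of pairwise unrelated
  maps is therefore finite.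
*)
theory Submission
  imports Defs
begin

section \<open>Lengths of images of letters and words under a substitution\<close>

definition maxlen :: "('a::finite list \<Rightarrow> 'a list) \<Rightarrow> nat" where
  "maxlen h = Max (range (\<lambda>a. length (h [a])))"

definition minlen :: "('a::finite list \<Rightarrow> 'a list) \<Rightarrow> nat" where
  "minlen h = Min (range (\<lambda>a. length (h [a])))"

text \<open>Recurrence is proved for this set of words; points of \<open>subst_shift \<tau>\<close>
  enter the argument only through their factors, which lie in it.\<close>

definition language :: "('a list \<Rightarrow> 'a list) \<Rightarrow> 'a list set" where
  "language \<tau> = {w. \<exists>a n. sublist w ((\<tau> ^^ n) [a])}"

lemma maxlen_ge: "length (h [a]) \<le> maxlen h"
  by (simp add: maxlen_def)

lemma minlen_le: "minlen h \<le> length (h [a])"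
  by (simp add: minlen_def)

lemma maxlen_attained: "\<exists>a. maxlen h = length (h [a])"
proof -
  have "maxlen h \<in> range (\<lambda>a. length (h [a]))"
    unfolding maxlen_def by (rule Max_in) auto
  then show ?thesis by auto
qed

lemma minlen_attained: "\<exists>a. minlen h = length (h [a])"
proof -
  have "minlen h \<in> range (\<lambda>a. length (h [a]))"
    unfolding minlen_def by (rule Min_in) auto
  then show ?thesis by auto
qed

lemma substitution_append: "substitution h \<Longrightarrow> h (u @ v) = h u @ h v"
  by (simp add: substitution_def)

lemma substitution_Cons: "substitution h \<Longrightarrow> h (a # v) = h [a] @ h v"
  using substitution_append[of h "[a]" v] by simp

lemma substitution_Nil: "substitution h \<Longrightarrow> h [] = []"
  using substitution_append[of h "[]" "[]"] by simp

lemma substitution_funpow: "substitution h \<Longrightarrow> substitution (h ^^ n)"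
  by (induction n) (auto simp: substitution_def)

lemma substitution_sublist: "substitution h \<Longrightarrow> sublist u v \<Longrightarrow> sublist (h u) (h v)"
  unfolding sublist_def by (metis substitution_append)

lemma length_substitution_le:
  assumes "substitution h"
  shows "length (h w) \<le> length w * maxlen h"
proof (induction w)
  case Nil
  show ?case by (simp add: substitution_Nil[OF assms])
next
  case (Cons a w)
  then show ?case using maxlen_ge[of h a] substitution_Cons[OF assms, of a w] by simp
qed

lemma length_substitution_ge:
  assumes "substitution h"
  shows "length w * minlen h \<le> length (h w)"
proof (induction w)
  case (Cons a w)
  then show ?case using minlen_le[of h a] substitution_Cons[OF assms, of a w] by simp
qed simp

section \<open>Locating factors of an image word in the preimage\<close>

text \<open>Discard the letters of \<open>v0\<close> whose images end before the occurrence of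
  \<open>w\<close> begins. The occurrence then starts inside the image of the first letter kept, at
  offset \<open>j\<close>.\<close>

lemma sublist_substitution_image:
  assumes h: "substitution h" and "sublist w (h v0)" "w \<noteq> []"
  shows "\<exists>a v j. suffix (a # v) v0 \<and> j < length (h [a]) \<and> prefix w (drop j (h (a # v)))"
  using assms(2)
proof (induction v0)
  case Nil
  then show ?case using assms(3) by (simp add: substitution_Nil[OF h])
next
  case (Cons a v0)
  then obtain p s where ps: "h [a] @ h v0 = p @ w @ s"
    by (auto simp: sublist_def substitution_Cons[OF h, of a v0])
  show ?case
  proof (cases "length p < length (h [a])")
    case True
    have "drop (length p) (h (a # v0)) = w @ s"
      using ps by (simp add: substitution_Cons[OF h, of a v0])
    then have "prefix w (drop (length p) (h (a # v0)))" by simp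
    with True show ?thesis by blast
  next
    case False
    then have "h v0 = drop (length (h [a])) p @ w @ s"
      using arg_cong[OF ps, of "drop (length (h [a]))"] by simp
    then have "sublist w (h v0)" by (auto simp: sublist_def)
    with Cons.IH obtain b v j where
      "suffix (b # v) v0" "j < length (h [b])" "prefix w (drop j (h (b # v)))" by blast
    then show ?thesis by (meson suffix_ConsI)
  qed
qed

lemma prefix_drop_appendD:
  assumes "prefix w (drop j (p @ s))" "j + length w \<le> length p"
  shows "prefix w (drop j p)"
proof -
  have "w = take (length w) (drop j (p @ s))"
    using assms(1) by (metis append_eq_conv_conj prefix_def)
  also have "\<dots> = take (length w) (drop j p)"
    using assms(2) by simp
  finally show ?thesis by (metis take_is_prefix)
qed

text \<open>An occurrence that starts inside one letter image and is no longer than any letter image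
  must end by the end of the next one.\<close>

lemma sublist_image_two_letters:
  assumes h: "substitution h" and "sublist w (h v0)" "length w \<le> minlen h"
  shows "\<exists>v. sublist v v0 \<and> length v \<le> 2 \<and> sublist w (h v)"
proof (cases "w = []")
  case True
  then show ?thesis by (intro exI[of _ "[]"]) auto
next
  case False
  then obtain a v j where *: "suffix (a # v) v0" "j < length (h [a])" "prefix w (drop j (h (a # v)))"
    using sublist_substitution_image[OF h assms(2)] by blast
  let ?v = "take 2 (a # v)"
  have hv: "h (a # v) = h ?v @ h (drop 2 (a # v))"
    by (metis append_take_drop_id substitution_append[OF h])
  have "prefix w (drop j (h ?v))"
  proof (cases v)
    case Nil
    then show ?thesis using * by simp
  next
    case (Cons b v')
    have "length (h ?v) = length (h [a]) + length (h [b])"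
      using substitution_Cons[OF h, of a "[b]"] Cons by (simp add: numeral_2_eq_2)
    then have "j + length w \<le> length (h ?v)"
      using *(2) assms(3) minlen_le[of h b] by linarith
    with *(3) show ?thesis unfolding hv by (rule prefix_drop_appendD)
  qed
  then have "sublist w (h ?v)"
    by (meson prefix_imp_sublist sublist_drop sublist_order.order_trans)
  moreover have "sublist ?v v0"
    by (meson *(1) suffix_imp_sublist sublist_order.order_trans sublist_take)
  ultimately show ?thesis by (intro exI[of _ ?v]) auto
qed

text \<open>The letter image in which \<open>w\<close> starts uses up at most
  \<open>maxlen h\<close> positions, so the following letter image fits entirely into the rest of
  \<open>w\<close>.\<close>

lemma long_word_contains_letter_image:
  assumes h: "substitution h" and "sublist w (h v0)" "2 * maxlen h \<le> length w" "0 < maxlen h"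
  shows "\<exists>b. sublist (h [b]) w"
proof -
  have "w \<noteq> []" using assms by auto
  then obtain a v j where *: "suffix (a # v) v0" "j < length (h [a])" "prefix w (drop j (h (a # v)))"
    using sublist_substitution_image[OF h assms(2)] by blast
  show ?thesis
  proof (cases v)
    case Nil
    \<comment> \<open>Impossible case: a single letter image is shorter than
      \<open>2 * maxlen h\<close>, as \<open>maxlen h\<close> is positive.\<close>
    then have "length w \<le> length (h [a])" using *(3) prefix_length_le by fastforce
    then show ?thesis using assms(3,4) maxlen_ge[of h a] by linarith
  next
    case (Cons b v')
    have "h (a # v) = h [a] @ h [b] @ h v'"
      using substitution_Cons[OF h, of a v] substitution_Cons[OF h, of b v'] Cons by simp
    with *(2,3) have 1: "prefix w ((drop j (h [a]) @ h [b]) @ h v')" by simp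
    have "length (drop j (h [a]) @ h [b]) \<le> length w"
      using assms(3) maxlen_ge[of h a] maxlen_ge[of h b] by simp
    then have "prefix (drop j (h [a]) @ h [b]) w"
      using 1 by (meson prefix_length_prefix prefixI)
    then have "sublist (drop j (h [a]) @ h [b]) w" by (rule prefix_imp_sublist)
    then have "sublist (h [b]) w"
      using sublist_append_leftI by (rule sublist_order.order_trans[rotated])
    then show ?thesis ..
  qed
qed

text \<open>The images of \<open>M\<close> letters have total length at least
  \<open>M * minlen h\<close>, enough to cover the offset, at most \<open>maxlen h\<close>, followed
  by \<open>w\<close>. Bounding \<open>v\<close> in this way makes the later pigeonhole
  finite.\<close>

lemma sublist_image_short_preimage:
  assumes h: "substitution h" and "sublist w (h v0)" "length w + maxlen h \<le> M * minlen h" "w \<noteq> []"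
  shows "\<exists>v j. length v \<le> M \<and> j \<le> maxlen h \<and> prefix w (drop j (h v))"
proof -
  obtain a v j where *: "suffix (a # v) v0" "j < length (h [a])" "prefix w (drop j (h (a # v)))"
    using sublist_substitution_image[OF h assms(2,4)] by blast
  let ?v = "take M (a # v)"
  have j: "j \<le> maxlen h" using *(2) maxlen_ge[of h a] by linarith
  have "prefix w (drop j (h ?v))"
  proof (cases "length (a # v) \<le> M")
    case True
    then show ?thesis using * by simp
  next
    case False
    then have "M * minlen h \<le> length (h ?v)"
      using length_substitution_ge[OF h, of ?v] by simp
    then have "j + length w \<le> length (h ?v)" using assms(3) j by linarith
    moreover have "h (a # v) = h ?v @ h (drop M (a # v))"
      by (metis append_take_drop_id substitution_append[OF h])
    ultimately show ?thesis using prefix_drop_appendD[of w j "h ?v"] *(3) by simp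
  qed
  then show ?thesis using j by (intro exI[of _ ?v] exI[of _ j]) auto
qed

section \<open>Growth of letter images and linear recurrence for primitive substitutions\<close>

locale primitive_substitution =
  fixes \<tau> :: "'a::finite list \<Rightarrow> 'a list"
  assumes subst: "substitution \<tau>" and prim: "primitive \<tau>"
begin

lemma subst_pow: "substitution (\<tau> ^^ n)"
  by (rule substitution_funpow[OF subst])

lemma pow_add: "(\<tau> ^^ (m + n)) w = (\<tau> ^^ m) ((\<tau> ^^ n) w)"
  by (simp add: funpow_add)

text \<open>Finiteness of the alphabet makes the threshold in primitivity uniform over all pairs of
  letters.\<close>

lemma eventually_all_letters: "\<exists>p. \<forall>n\<ge>p. \<forall>a b. sublist [a] ((\<tau> ^^ n) [b])"
proof -
  have "\<forall>\<^sub>F n in sequentially. \<forall>a b. sublist [a] ((\<tau> ^^ n) [b])"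
    using prim by (simp add: primitive_def eventually_all_finite)
  then show ?thesis by (simp add: eventually_sequentially)
qed

lemma nonerasing: "\<tau> [a] \<noteq> []"
proof
  assume "\<tau> [a] = []"
  then have "(\<tau> ^^ Suc n) [a] = []" for n
    using substitution_Nil[OF subst_pow[of n]] by (simp only: funpow_Suc_right o_apply)
  \<comment> \<open>The exponent is taken as a successor because an erased letter has empty images
    only at positive exponents.\<close>
  moreover obtain p where "sublist [a] ((\<tau> ^^ Suc p) [a])"
    using eventually_all_letters by (meson le_Suc_eq order_refl)
  ultimately show False by simp
qed

lemma length_mono: "length w \<le> length (\<tau> w)"
proof -
  have "1 \<le> minlen \<tau>"
    using minlen_attained[of \<tau>] nonerasing by (metis One_nat_def Suc_leI length_greater_0_conv)
  then have "length w * 1 \<le> length w * minlen \<tau>" by (rule mult_le_mono2)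
  also have "\<dots> \<le> length (\<tau> w)" by (rule length_substitution_ge[OF subst])
  finally show ?thesis by simp
qed

lemma length_pow_mono: "m \<le> n \<Longrightarrow> length ((\<tau> ^^ m) w) \<le> length ((\<tau> ^^ n) w)"
proof (induction n rule: dec_induct)
  case (step n)
  then show ?case using length_mono[of "(\<tau> ^^ n) w"] by simp
qed simp

lemma maxlen_mono: "m \<le> n \<Longrightarrow> maxlen (\<tau> ^^ m) \<le> maxlen (\<tau> ^^ n)"
proof -
  assume "m \<le> n"
  obtain a where "maxlen (\<tau> ^^ m) = length ((\<tau> ^^ m) [a])" using maxlen_attained by blast
  then show ?thesis
    using length_pow_mono[OF \<open>m \<le> n\<close>, of "[a]"] maxlen_ge[of "\<tau> ^^ n" a] by linarith
qed

lemma maxlen_pos: "1 \<le> maxlen (\<tau> ^^ n)"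
  using length_pow_mono[of 0 n "[undefined]"] maxlen_ge[of "\<tau> ^^ n" undefined] by simp

lemma maxlen_add: "maxlen (\<tau> ^^ (m + n)) \<le> maxlen (\<tau> ^^ m) * maxlen (\<tau> ^^ n)"
proof -
  obtain a where "maxlen (\<tau> ^^ (m + n)) = length ((\<tau> ^^ m) ((\<tau> ^^ n) [a]))"
    using maxlen_attained[of "\<tau> ^^ (m + n)"] by (auto simp: pow_add)
  also have "\<dots> \<le> length ((\<tau> ^^ n) [a]) * maxlen (\<tau> ^^ m)"
    by (rule length_substitution_le[OF subst_pow])
  also have "\<dots> \<le> maxlen (\<tau> ^^ n) * maxlen (\<tau> ^^ m)"
    by (rule mult_le_mono1[OF maxlen_ge])
  finally show ?thesis by (simp add: mult.commute)
qed

text \<open>With \<open>n = m + p\<close>, the image of every letter under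
  \<open>\<tau> ^^ p\<close> contains all letters, so the shortest image at level \<open>n\<close>
  is at least as long as the longest at level \<open>m\<close>. The last \<open>p\<close> steps
  lengthen images by at most the factor \<open>C = maxlen (\<tau> ^^ p)\<close>.\<close>

lemma maxlen_le_minlen: "\<exists>p C. 1 \<le> C \<and> (\<forall>n\<ge>p. maxlen (\<tau> ^^ n) \<le> C * minlen (\<tau> ^^ n))"
proof -
  obtain p where p: "\<And>a b. sublist [a] ((\<tau> ^^ p) [b])"
    using eventually_all_letters by blast
  have "maxlen (\<tau> ^^ n) \<le> maxlen (\<tau> ^^ p) * minlen (\<tau> ^^ n)" if "p \<le> n" for n
  proof -
    obtain m where n: "n = m + p" using \<open>p \<le> n\<close> by (metis le_add_diff_inverse2)
    obtain b where b: "minlen (\<tau> ^^ n) = length ((\<tau> ^^ m) ((\<tau> ^^ p) [b]))"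
      using minlen_attained[of "\<tau> ^^ n"] by (auto simp: n pow_add)
    obtain a where a: "maxlen (\<tau> ^^ m) = length ((\<tau> ^^ m) [a])"
      using maxlen_attained by blast
    have "maxlen (\<tau> ^^ m) \<le> minlen (\<tau> ^^ n)"
      unfolding a b using substitution_sublist[OF subst_pow p] by (rule sublist_length_le)
    then have "maxlen (\<tau> ^^ m) * maxlen (\<tau> ^^ p) \<le> minlen (\<tau> ^^ n) * maxlen (\<tau> ^^ p)"
      by (rule mult_le_mono1)
    with maxlen_add[of m p] have "maxlen (\<tau> ^^ n) \<le> minlen (\<tau> ^^ n) * maxlen (\<tau> ^^ p)"
      unfolding n by (rule order_trans)
    then show ?thesis by (simp only: mult.commute)
  qed
  then show ?thesis using maxlen_pos by blast
qed

lemma language_eventually: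
  assumes "u \<in> language \<tau>"
  shows "\<exists>q. \<forall>n\<ge>q. \<forall>b. sublist u ((\<tau> ^^ n) [b])"
proof -
  obtain a m where u: "sublist u ((\<tau> ^^ m) [a])"
    using assms by (auto simp: language_def)
  obtain p where p: "\<And>n a b. p \<le> n \<Longrightarrow> sublist [a] ((\<tau> ^^ n) [b])"
    using eventually_all_letters by blast
  have "sublist u ((\<tau> ^^ n) [b])" if "m + p \<le> n" for n b
  proof -
    obtain k where n: "n = m + (p + k)" using le_Suc_ex[OF \<open>m + p \<le> n\<close>] by (auto simp: add.assoc)
    have "sublist ((\<tau> ^^ m) [a]) ((\<tau> ^^ n) [b])"
      unfolding n pow_add[of m] by (intro substitution_sublist[OF subst_pow] p) simp
    with u show ?thesis by (rule sublist_order.order_trans)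
  qed
  then show ?thesis by blast
qed

text \<open>Since \<open>u\<close> occurs in all high iterates of a letter, the exponent can be
  taken as \<open>n + q\<close> and split. Here \<open>undefined\<close> is merely some
  letter.\<close>

lemma language_desubstitute:
  assumes "u \<in> language \<tau>"
  shows "\<exists>v\<in>language \<tau>. sublist u ((\<tau> ^^ n) v)"
proof -
  obtain q where "\<And>m b. m \<ge> q \<Longrightarrow> sublist u ((\<tau> ^^ m) [b])"
    using language_eventually[OF assms] by blast
  then have "sublist u ((\<tau> ^^ n) ((\<tau> ^^ q) [undefined]))"
    unfolding pow_add[symmetric] by simp
  moreover have "(\<tau> ^^ q) [undefined] \<in> language \<tau>" by (auto simp: language_def)
  ultimately show ?thesis by blast
qed

lemma language_sublist: "v \<in> language \<tau> \<Longrightarrow> sublist u v \<Longrightarrow> u \<in> language \<tau>"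
  unfolding language_def by (blast intro: sublist_order.order_trans)

text \<open>A word no longer than the letter images at level \<open>n\<close> is covered by the
  image of a word of the language with at most two letters. There are finitely many of these, so one
  \<open>q\<close>, independent of \<open>n\<close>, puts them all into every
  \<open>(\<tau> ^^ q) [b]\<close>.\<close>

lemma language_scale:
  "\<exists>q. \<forall>n u c. u \<in> language \<tau> \<longrightarrow> length u \<le> minlen (\<tau> ^^ n) \<longrightarrow> sublist u ((\<tau> ^^ (n + q)) [c])"
proof -
  let ?W = "{v \<in> language \<tau>. length v \<le> 2}"
  have "finite ?W"
    by (rule finite_subset[OF _ finite_lists_length_le[OF finite, of UNIV 2]]) auto
  moreover have "\<forall>v\<in>?W. \<forall>\<^sub>F q in sequentially. \<forall>b. sublist v ((\<tau> ^^ q) [b])"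
    using language_eventually by (auto simp: eventually_sequentially)
  ultimately have "\<forall>\<^sub>F q in sequentially. \<forall>v\<in>?W. \<forall>b. sublist v ((\<tau> ^^ q) [b])"
    by (rule eventually_ball_finite)
  then obtain q where q: "\<And>v b. v \<in> language \<tau> \<Longrightarrow> length v \<le> 2 \<Longrightarrow> sublist v ((\<tau> ^^ q) [b])"
    by (auto simp: eventually_sequentially)
  have "sublist u ((\<tau> ^^ (n + q)) [c])"
    if u: "u \<in> language \<tau>" "length u \<le> minlen (\<tau> ^^ n)" for n u c
  proof -
    obtain v0 where "v0 \<in> language \<tau>" "sublist u ((\<tau> ^^ n) v0)"
      using language_desubstitute[OF u(1)] by blast
    then obtain v where "v \<in> language \<tau>" "length v \<le> 2" "sublist u ((\<tau> ^^ n) v)"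
      using sublist_image_two_letters[OF subst_pow _ u(2)] language_sublist by blast
    then have "sublist ((\<tau> ^^ n) v) ((\<tau> ^^ (n + q)) [c])"
      unfolding pow_add by (intro substitution_sublist[OF subst_pow] q)
    with \<open>sublist u ((\<tau> ^^ n) v)\<close> show ?thesis by (rule sublist_order.order_trans)
  qed
  then show ?thesis by blast
qed

text \<open>Turns the presence of long words in the language into long letter images, at levels
  beyond any threshold \<open>p\<close>.\<close>

lemma language_unbounded_maxlen:
  assumes "w \<in> language \<tau>" "w \<noteq> []"
  shows "\<exists>n\<ge>p. length w \<le> maxlen (\<tau> ^^ n)"
proof -
  obtain a m where "sublist w ((\<tau> ^^ m) [a])" using assms by (auto simp: language_def)
  then have "length w \<le> maxlen (\<tau> ^^ m)"
    using sublist_length_le[of w] maxlen_ge[of "\<tau> ^^ m" a] order_trans by blast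
  also have "\<dots> \<le> maxlen (\<tau> ^^ (m + p))" by (rule maxlen_mono) simp
  finally show ?thesis by (intro exI[of _ "m + p"]) simp
qed

text \<open>Choose a level \<open>n\<close> at which all letter images have length comparable to
  \<open>l\<close>. Every letter image at level \<open>n + q\<close> contains every such
  \<open>u\<close>, and a word twice as long as the longest of these images contains one of
  them.\<close>

lemma linear_recurrence:
  assumes unbounded: "\<And>n. \<exists>w\<in>language \<tau>. n \<le> length w"
  shows "\<exists>K. \<forall>l\<ge>1. \<forall>u\<in>language \<tau>. \<forall>w\<in>language \<tau>.
           length u \<le> l \<longrightarrow> K * l \<le> length w \<longrightarrow> sublist u w"
proof -
  obtain p C where C: "1 \<le> C" "\<And>n. p \<le> n \<Longrightarrow> maxlen (\<tau> ^^ n) \<le> C * minlen (\<tau> ^^ n)"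
    using maxlen_le_minlen by blast
  obtain q where q: "\<And>n u c. u \<in> language \<tau> \<Longrightarrow> length u \<le> minlen (\<tau> ^^ n) \<Longrightarrow>
      sublist u ((\<tau> ^^ (n + q)) [c])"
    using language_scale by blast
  define E where "E = maxlen (\<tau> ^^ p) + maxlen (\<tau> ^^ 1) * C"
  have scale: "\<exists>n. l \<le> minlen (\<tau> ^^ n) \<and> maxlen (\<tau> ^^ n) \<le> E * l" if l: "1 \<le> l" for l
  proof -
    have ex: "\<exists>n. l \<le> minlen (\<tau> ^^ n)"
    proof -
      \<comment> \<open>The factor \<open>C\<close> is cancelled below by the comparison of
        \<open>maxlen\<close> with \<open>minlen\<close>.\<close>
      obtain w where w: "w \<in> language \<tau>" "C * l \<le> length w" using unbounded by blast
      moreover have "w \<noteq> []" using w C(1) l by auto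
      ultimately obtain n where n: "n \<ge> p" "length w \<le> maxlen (\<tau> ^^ n)"
        using language_unbounded_maxlen by blast
      then have "C * l \<le> C * minlen (\<tau> ^^ n)" using C(2)[OF n(1)] w(2) by linarith
      then show ?thesis using C(1) by auto
    qed
    \<comment> \<open>Minimality keeps the level from being too high: at the preceding level some
      letter image is shorter than \<open>l\<close>.\<close>
    define n where "n = (LEAST n. l \<le> minlen (\<tau> ^^ n))"
    have n: "l \<le> minlen (\<tau> ^^ n)" unfolding n_def using ex by (rule LeastI_ex)
    have "maxlen (\<tau> ^^ n) \<le> E * l"
    proof (cases "n \<le> p")
      case True
      then have "maxlen (\<tau> ^^ n) \<le> maxlen (\<tau> ^^ p) * 1" using maxlen_mono by simp
      also have "\<dots> \<le> E * l" unfolding E_def using l by (intro mult_le_mono) auto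
      finally show ?thesis .
    next
      case False
      then obtain m where m: "n = 1 + m" "p \<le> m" by (cases n) auto
      have "\<not> l \<le> minlen (\<tau> ^^ m)" using not_less_Least[of m "\<lambda>n. l \<le> minlen (\<tau> ^^ n)"] m
        by (simp add: n_def)
      then have "C * minlen (\<tau> ^^ m) \<le> C * l" by simp
      then have "maxlen (\<tau> ^^ m) \<le> C * l" using C(2)[OF m(2)] by linarith
      then have "maxlen (\<tau> ^^ 1) * maxlen (\<tau> ^^ m) \<le> maxlen (\<tau> ^^ 1) * (C * l)" by (rule mult_le_mono2)
      with maxlen_add[of 1 m] have "maxlen (\<tau> ^^ n) \<le> maxlen (\<tau> ^^ 1) * (C * l)"
        unfolding m(1) by (rule order_trans)
      also have "\<dots> \<le> E * l" unfolding E_def by (simp add: algebra_simps)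
      finally show ?thesis .
    qed
    with n show ?thesis by blast
  qed
  define K where "K = 2 * (maxlen (\<tau> ^^ q) * E)"
  have "sublist u w" if l: "1 \<le> l" and u: "u \<in> language \<tau>" "length u \<le> l"
    and w: "w \<in> language \<tau>" "K * l \<le> length w" for l u w
  proof -
    obtain n where n: "l \<le> minlen (\<tau> ^^ n)" "maxlen (\<tau> ^^ n) \<le> E * l" using scale[OF l] by blast
    have "maxlen (\<tau> ^^ (n + q)) \<le> maxlen (\<tau> ^^ n) * maxlen (\<tau> ^^ q)" by (rule maxlen_add)
    also have "\<dots> \<le> E * l * maxlen (\<tau> ^^ q)" by (rule mult_le_mono1[OF n(2)])
    finally have "2 * maxlen (\<tau> ^^ (n + q)) \<le> length w"
      using w(2) by (simp add: K_def mult.assoc mult.commute mult.left_commute)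
    moreover obtain v where "sublist w ((\<tau> ^^ (n + q)) v)"
      using language_desubstitute[OF w(1)] by blast
    moreover have "0 < maxlen (\<tau> ^^ (n + q))" using maxlen_pos[of "n + q"] by linarith
    ultimately obtain b where b: "sublist ((\<tau> ^^ (n + q)) [b]) w"
      using long_word_contains_letter_image[OF subst_pow] by blast
    have "sublist u ((\<tau> ^^ (n + q)) [b])"
      using u n(1) by (intro q) auto
    then show ?thesis using b by (rule sublist_order.order_trans)
  qed
  then show ?thesis by blast
qed

end

section \<open>Cylinders, compactness and the local rule of a block map\<close>

lemma funpow_shift: "(shift ^^ k) x i = x (i + k)"
  by (induction k arbitrary: i) (auto simp: shift_def)

lemma topspace_sequence_topology: "topspace sequence_topology = UNIV"
  by (simp add: sequence_topology_def)

lemma compact_space_sequence_topology: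
  "compact_space (sequence_topology :: (nat \<Rightarrow> 'a::finite) topology)"
  unfolding sequence_topology_def compact_space_product_topology
  by (simp add: compact_space_discrete_topology)

lemma openin_cylinder: "openin sequence_topology {z. \<forall>i<r. z i = x i}"
proof -
  have "openin sequence_topology (Pi\<^sub>E UNIV (\<lambda>i::nat. if i < r then {x i} else UNIV))"
    unfolding sequence_topology_def
    by (rule product_topology_basis) (auto intro: finite_subset[of _ "{..<r}"])
  moreover have "Pi\<^sub>E UNIV (\<lambda>i. if i < r then {x i} else UNIV) = {z. \<forall>i<r. z i = x i}"
    by (auto simp: PiE_iff split: if_splits)
  ultimately show ?thesis by simp
qed

lemma openin_contains_cylinder:
  assumes "openin sequence_topology U" "x \<in> U"
  shows "\<exists>r. {z. \<forall>i<r. z i = x i} \<subseteq> U"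
proof -
  obtain V where V: "finite {i. V i \<noteq> UNIV}" "x \<in> Pi\<^sub>E UNIV V" "Pi\<^sub>E UNIV V \<subseteq> U"
    using assms unfolding sequence_topology_def openin_product_topology_alt by auto
  obtain r where r: "\<And>i. V i \<noteq> UNIV \<Longrightarrow> i < r"
    using finite_nat_set_iff_bounded[THEN iffD1, OF V(1)] by auto
  have "{z. \<forall>i<r. z i = x i} \<subseteq> Pi\<^sub>E UNIV V"
  proof
    fix z assume z: "z \<in> {z. \<forall>i<r. z i = x i}"
    have "z i \<in> V i" for i
      using r[of i] z V(2) by (cases "V i = UNIV") (auto simp: PiE_iff)
    then show "z \<in> Pi\<^sub>E UNIV V" by (simp add: PiE_iff)
  qed
  with V(3) show ?thesis by blast
qed

text \<open>A one-sided window for coordinate 0 only; for block maps the other coordinates follow by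
  commuting with the shift.\<close>

definition has_radius ::
    "(nat \<Rightarrow> 'a) set \<Rightarrow> ((nat \<Rightarrow> 'a) \<Rightarrow> (nat \<Rightarrow> 'b)) \<Rightarrow> nat \<Rightarrow> bool" where
  "has_radius X f r \<longleftrightarrow> (\<forall>x\<in>X. \<forall>y\<in>X. (\<forall>i<r. x i = y i) \<longrightarrow> f x 0 = f y 0)"

lemmas has_radiusD = has_radius_def[THEN iffD1, rule_format]

lemma has_radius_mono:
  assumes "has_radius X f r" "r \<le> s"
  shows "has_radius X f s"
  unfolding has_radius_def
proof (intro ballI impI)
  fix x y assume "x \<in> X" "y \<in> X" "\<forall>i<s. x i = y i"
  then show "f x 0 = f y 0"
    using assms(2) by (intro has_radiusD[OF assms(1)]) auto
qed

text \<open>The Curtis-Hedlund-Lyndon argument: continuity gives a window around each point, and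
  compactness of \<open>X\<close> reduces these to finitely many.\<close>

lemma block_map_has_radius:
  fixes X :: "(nat \<Rightarrow> 'a::finite) set"
  assumes "closedin sequence_topology X" "block_map X Y f"
  shows "\<exists>r. has_radius X f r"
proof -
  have "continuous_map (subtopology sequence_topology X) sequence_topology f"
    using assms(2) by (simp add: block_map_def continuous_map_in_subtopology)
  then have cont: "continuous_map (subtopology sequence_topology X) (discrete_topology UNIV) (\<lambda>x. f x 0)"
    unfolding sequence_topology_def[where 'a='b] continuous_map_componentwise_UNIV by blast
  have top: "topspace (subtopology sequence_topology X) = X"
    by (simp add: topspace_sequence_topology)
  have "\<exists>r. \<forall>z\<in>X. (\<forall>i<r. z i = x i) \<longrightarrow> f z 0 = f x 0" if "x \<in> X" for x
  proof -
    have "openin (subtopology sequence_topology X) {z \<in> X. f z 0 \<in> {f x 0}}"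
      using openin_continuous_map_preimage[OF cont, of "{f x 0}"] unfolding top by simp
    then obtain U where "openin sequence_topology U" "{z \<in> X. f z 0 \<in> {f x 0}} = U \<inter> X"
      by (auto simp: openin_subtopology)
    moreover from this(2) that have "x \<in> U" by blast
    ultimately show ?thesis using openin_contains_cylinder[of U x] by blast
  qed
  then obtain r where r: "\<And>x z. x \<in> X \<Longrightarrow> z \<in> X \<Longrightarrow> (\<forall>i<r x. z i = x i) \<Longrightarrow> f z 0 = f x 0"
    by metis
  let ?C = "\<lambda>x. {z. \<forall>i<r x. z i = x i}"
  have "compactin sequence_topology X"
    by (rule closedin_compact_space[OF compact_space_sequence_topology assms(1)])
  then have "\<exists>\<F>. finite \<F> \<and> \<F> \<subseteq> ?C ` X \<and> X \<subseteq> \<Union>\<F>"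
    by (rule compactinD) (auto intro: openin_cylinder)
  then obtain \<F> where \<F>: "finite \<F>" "\<F> \<subseteq> ?C ` X" "X \<subseteq> \<Union>\<F>" by blast
  obtain F where F: "finite F" "F \<subseteq> X" "X \<subseteq> (\<Union>x\<in>F. ?C x)"
    using finite_subset_image[OF \<F>(1,2)] \<F>(3) by auto
  \<comment> \<open>The sum is a convenient common upper bound of the finitely many radii, valid
    also when \<open>F\<close> is empty.\<close>
  have "has_radius X f (\<Sum>x\<in>F. r x)"
    unfolding has_radius_def
  proof (intro ballI impI)
    fix y z assume y: "y \<in> X" and z: "z \<in> X" and yz: "\<forall>i<\<Sum>x\<in>F. r x. y i = z i"
    obtain x where x: "x \<in> F" "y \<in> ?C x" using F(3) y by blast
    have "r x \<le> (\<Sum>x\<in>F. r x)" using F(1) x(1) by (intro member_le_sum) auto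
    then have "z \<in> ?C x" using x(2) yz by (auto dest: less_le_trans)
    then have "f y 0 = f x 0" "f z 0 = f x 0" using r x F(2) y z by blast+
    then show "f y 0 = f z 0" by simp
  qed
  then show ?thesis ..
qed

lemma exists_common_radius:
  assumes "finite S" "\<And>f. f \<in> S \<Longrightarrow> \<exists>r. has_radius X f r"
  shows "\<exists>r. \<forall>f\<in>S. has_radius X f r"
proof -
  obtain r where r: "\<And>f. f \<in> S \<Longrightarrow> has_radius X f (r f)" using assms(2) by metis
  have "has_radius X f (\<Sum>f\<in>S. r f)" if "f \<in> S" for f
    by (rule has_radius_mono[OF r[OF that]]) (use assms(1) that in \<open>auto intro: member_le_sum\<close>)
  then show ?thesis by blast
qed

section \<open>Block maps on substitution subshifts, compared up to a shift\<close>

lemma subst_shift_factor: "x \<in> subst_shift \<tau> \<Longrightarrow> map x [i..<j] \<in> language \<tau>"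
  by (simp add: subst_shift_def language_def)

lemma subst_shift_funpow: "x \<in> subst_shift \<tau> \<Longrightarrow> (shift ^^ k) x \<in> subst_shift \<tau>"
  using subshift_subst_shift[of \<tau>] by (induction k) (auto simp: subshift_def)

lemma block_map_in: "block_map X Y f \<Longrightarrow> x \<in> X \<Longrightarrow> f x \<in> Y"
  by (auto simp: block_map_def continuous_map_in_subtopology sequence_topology_def Pi_iff)

lemma block_map_funpow:
  assumes "block_map (subst_shift \<tau>) Y f" "x \<in> subst_shift \<tau>"
  shows "f ((shift ^^ k) x) = (shift ^^ k) (f x)"
proof (induction k)
  case (Suc k)
  then show ?case
    using assms(1) subst_shift_funpow[OF assms(2), of k] by (simp add: block_map_def)
qed simp

text \<open>Only values on \<open>X\<close> are compared, since block maps are arbitrary elsewhere.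
  Just reflexivity and symmetry are established; a maximality argument takes the place of
  equivalence classes.\<close>

definition shift_related ::
    "(nat \<Rightarrow> 'a) set \<Rightarrow> ((nat \<Rightarrow> 'a) \<Rightarrow> (nat \<Rightarrow> 'b)) \<Rightarrow> ((nat \<Rightarrow> 'a) \<Rightarrow> (nat \<Rightarrow> 'b)) \<Rightarrow> bool" where
  "shift_related X f g \<longleftrightarrow>
     (\<exists>k. (\<forall>x\<in>X. f x = (shift ^^ k) (g x)) \<or> (\<forall>x\<in>X. g x = (shift ^^ k) (f x)))"

lemma shift_related_refl: "shift_related X f f"
  unfolding shift_related_def by (rule exI[of _ 0]) simp

lemma shift_related_sym: "shift_related X f g \<Longrightarrow> shift_related X g f"
  unfolding shift_related_def by (simp only: disj_commute)

text \<open>The first \<open>r + k\<close> letters of \<open>z\<close> determine both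
  \<open>g z 0\<close> and \<open>f z k\<close>. They occur in the prefix of \<open>x\<close> at
  some position \<open>t\<close>, where the two values are \<open>g x t\<close> and
  \<open>f x (t + k)\<close>, which agree.\<close>

lemma block_maps_eq_of_long_agreement:
  assumes f: "block_map (subst_shift \<tau>) Y f" "has_radius (subst_shift \<tau>) f r"
    and g: "block_map (subst_shift \<tau>) Y g" "has_radius (subst_shift \<tau>) g r"
    and x: "x \<in> subst_shift \<tau>"
    and recur: "\<And>u. u \<in> language \<tau> \<Longrightarrow> length u \<le> r + k \<Longrightarrow> sublist u (map x [0..<T])"
    and agree: "\<And>t. t \<le> T \<Longrightarrow> g x t = f x (t + k)"
    and z: "z \<in> subst_shift \<tau>"
  shows "g z = (shift ^^ k) (f z)"
proof -
  \<comment> \<open>Coordinate 0 suffices: coordinate \<open>m\<close> follows by applying this to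
    the \<open>m\<close>-fold shift of \<open>z\<close>.\<close>
  have main: "g z 0 = f z k" if z: "z \<in> subst_shift \<tau>" for z
  proof -
    have "sublist (map z [0..<r + k]) (map x [0..<T])"
      by (rule recur[OF subst_shift_factor[OF z]]) simp
    then obtain p s where ps: "map x [0..<T] = p @ map z [0..<r + k] @ s"
      by (auto simp: sublist_def)
    let ?t = "length p"
    have t: "?t + (r + k) \<le> T"
      using arg_cong[OF ps, of length] by simp
    have eq: "x (i + ?t) = z i" if "i < r + k" for i
    proof -
      have "map x [0..<T] ! (?t + i) = z i" using that by (simp add: ps nth_append)
      then show ?thesis using that t by (simp add: add.commute)
    qed
    have X: "(shift ^^ ?t) x \<in> subst_shift \<tau>" "(shift ^^ (?t + k)) x \<in> subst_shift \<tau>"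
        "(shift ^^ k) z \<in> subst_shift \<tau>"
      using x z by (auto intro: subst_shift_funpow)
    have "g z 0 = g ((shift ^^ ?t) x) 0"
      by (rule has_radiusD[OF g(2) z X(1)]) (simp add: eq funpow_shift)
    also have "\<dots> = g x ?t" by (simp add: block_map_funpow[OF g(1) x] funpow_shift)
    also have "\<dots> = f x (?t + k)" using t by (intro agree) simp
    also have "\<dots> = f ((shift ^^ (?t + k)) x) 0" by (simp add: block_map_funpow[OF f(1) x] funpow_shift)
    also have "\<dots> = f ((shift ^^ k) z) 0"
    proof (rule has_radiusD[OF f(2) X(2,3)])
      fix i assume "i < r"
      then have "x (i + k + ?t) = z (i + k)" by (intro eq) simp
      then show "(shift ^^ (?t + k)) x i = (shift ^^ k) z i"
        by (simp only: funpow_shift add.assoc add.commute[of k])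
    qed
    also have "\<dots> = f z k" by (simp add: block_map_funpow[OF f(1) z] funpow_shift)
    finally show ?thesis .
  qed
  show ?thesis
  proof
    fix m
    have "g ((shift ^^ m) z) 0 = f ((shift ^^ m) z) k"
      by (rule main[OF subst_shift_funpow[OF z]])
    then show "g z m = (shift ^^ k) (f z) m"
      by (simp add: block_map_funpow[OF f(1) z] block_map_funpow[OF g(1) z] funpow_shift add.commute)
  qed
qed

section \<open>Pigeonhole on bounded preimages\<close>

text \<open>The point is that \<open>N\<close> is chosen before \<open>S\<close>: radius, level and
  prefix length all depend on \<open>S\<close>, but the number of candidate preimage words does
  not.\<close>

lemma exists_shift_related_pair:
  fixes \<tau> :: "'a::finite list \<Rightarrow> 'a list" and \<rho> :: "'b::finite list \<Rightarrow> 'b list"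
  assumes "primitive_substitution \<tau>" "primitive_substitution \<rho>"
  shows "\<exists>N. \<forall>S. finite S \<longrightarrow> S \<subseteq> Collect (block_map (subst_shift \<tau>) (subst_shift \<rho>)) \<longrightarrow> N < card S \<longrightarrow>
           (\<exists>f\<in>S. \<exists>g\<in>S. f \<noteq> g \<and> shift_related (subst_shift \<tau>) f g)"
proof (cases "subst_shift \<tau> = {}")
  \<comment> \<open>On an empty domain all maps are vacuously related, so \<open>N = 1\<close>
    works.\<close>
  case True
  have "\<exists>f\<in>S. \<exists>g\<in>S. f \<noteq> g \<and> shift_related (subst_shift \<tau>) f g"
    if "finite S" "1 < card S" for S :: "((nat \<Rightarrow> 'a) \<Rightarrow> (nat \<Rightarrow> 'b)) set"
  proof -
    have "\<not> (\<exists>a. S \<subseteq> {a})" using that card_mono[of "{_}" S] by fastforce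
    then obtain f g where "f \<in> S" "g \<in> S" "f \<noteq> g" by blast
    then show ?thesis using True by (auto simp: shift_related_def)
  qed
  then show ?thesis by blast
next
  case False
  then obtain x where x: "x \<in> subst_shift \<tau>" by blast
  interpret T: primitive_substitution \<tau> by fact
  interpret R: primitive_substitution \<rho> by fact
  have "\<exists>w\<in>language \<tau>. n \<le> length w" for n
    using subst_shift_factor[OF x, of 0 n] by (intro bexI[of _ "map x [0..<n]"]) auto
  then obtain K where K: "\<And>l u w. 1 \<le> l \<Longrightarrow> u \<in> language \<tau> \<Longrightarrow> w \<in> language \<tau> \<Longrightarrow> length u \<le> l \<Longrightarrow>
      K * l \<le> length w \<Longrightarrow> sublist u w"
    using T.linear_recurrence by blast
  obtain p C where C: "1 \<le> C" "\<And>n. p \<le> n \<Longrightarrow> maxlen (\<rho> ^^ n) \<le> C * minlen (\<rho> ^^ n)"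
    using R.maxlen_le_minlen by blast
  \<comment> \<open>Chosen so that \<open>M\<close> letter images at level \<open>n\<close> cover
    \<open>L + s\<close> positions; it involves only the recurrence constant of
    \<open>\<tau>\<close> and the comparability constant of \<open>\<rho>\<close>.\<close>
  define M where "M = (2 * K + 3) * C"
  let ?V = "{v :: 'b list. length v \<le> M}"
  have finV: "finite ?V" using finite_lists_length_le[of "UNIV :: 'b set" M] by simp
  have "\<exists>f\<in>S. \<exists>g\<in>S. f \<noteq> g \<and> shift_related (subst_shift \<tau>) f g"
    if S: "finite S" "S \<subseteq> Collect (block_map (subst_shift \<tau>) (subst_shift \<rho>))" "card ?V < card S" for S
  proof -
    have bm: "block_map (subst_shift \<tau>) (subst_shift \<rho>) f" if "f \<in> S" for f
      using S(2) that by blast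
    obtain r where r: "\<And>f. f \<in> S \<Longrightarrow> has_radius (subst_shift \<tau>) f r"
      using exists_common_radius[OF S(1)] block_map_has_radius subshift_subst_shift bm
      unfolding subshift_def by metis
    have "S \<noteq> {}" using S(3) by auto
    then obtain f0 where "f0 \<in> S" by blast
    then have "f0 x \<in> subst_shift \<rho>" using bm block_map_in x by blast
    \<comment> \<open>Length \<open>Suc r\<close> makes the word nonempty and yields
      \<open>r < s\<close> below.\<close>
    then have "map (f0 x) [0..<Suc r] \<in> language \<rho>" by (rule subst_shift_factor)
    then obtain n where n: "p \<le> n" "Suc r \<le> maxlen (\<rho> ^^ n)"
      using R.language_unbounded_maxlen[of _ p] by force
    define s where "s = maxlen (\<rho> ^^ n)"
    \<comment> \<open>Agreement is needed at positions \<open>t\<close> up to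
      \<open>K * (r + s)\<close> and is read at \<open>t + k\<close> with \<open>k \<le> s\<close>;
      the final 1 makes \<open>t + k < L\<close> strict.\<close>
    define L where "L = K * (r + s) + s + 1"
    have "K * (r + s) \<le> K * (2 * s)"
      using n(2) unfolding s_def by (intro mult_le_mono2) linarith
    then have "L \<le> K * (2 * s) + 2 * s"
      using n(2) unfolding L_def s_def by linarith
    then have "L + s \<le> (2 * K + 3) * s" by (simp add: algebra_simps)
    also have "\<dots> \<le> (2 * K + 3) * (C * minlen (\<rho> ^^ n))"
      using C(2)[OF n(1)] unfolding s_def by (rule mult_le_mono2)
    finally have L: "L + s \<le> M * minlen (\<rho> ^^ n)" by (simp only: M_def mult.assoc)
    have "\<exists>v j. length v \<le> M \<and> j \<le> s \<and> prefix (map (f x) [0..<L]) (drop j ((\<rho> ^^ n) v))"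
      if f: "f \<in> S" for f
    proof -
      have "f x \<in> subst_shift \<rho>" using bm block_map_in x f by blast
      then have "map (f x) [0..<L] \<in> language \<rho>" by (rule subst_shift_factor)
      then obtain v0 where "sublist (map (f x) [0..<L]) ((\<rho> ^^ n) v0)"
        using R.language_desubstitute by blast
      then show ?thesis unfolding s_def
        by (rule sublist_image_short_preimage[OF R.subst_pow]) (use L in \<open>auto simp: s_def L_def\<close>)
    qed
    then obtain v j where vj: "\<And>f. f \<in> S \<Longrightarrow> length (v f) \<le> M" "\<And>f. f \<in> S \<Longrightarrow> j f \<le> s"
        "\<And>f. f \<in> S \<Longrightarrow> prefix (map (f x) [0..<L]) (drop (j f) ((\<rho> ^^ n) (v f)))"
      by metis
    have "\<not> inj_on v S"
    proof
      assume "inj_on v S"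
      then have "card S \<le> card ?V" using vj(1) finV by (intro card_inj_on_le[of v]) auto
      with S(3) show False by simp
    qed
    \<comment> \<open>The order of the offsets is no restriction, as \<open>f\<close> and
      \<open>g\<close> may be exchanged.\<close>
    then obtain f g where fg: "f \<in> S" "g \<in> S" "f \<noteq> g" "v f = v g" "j f \<le> j g"
      unfolding inj_on_def by (metis nle_le)
    have coord: "h x t = (\<rho> ^^ n) (v h) ! (j h + t)" if h: "h \<in> S" "t < L" for h t
    proof -
      obtain q where q: "drop (j h) ((\<rho> ^^ n) (v h)) = map (h x) [0..<L] @ q"
        using vj(3)[OF h(1)] by (auto simp: prefix_def)
      have "j h \<le> length ((\<rho> ^^ n) (v h))"
        using arg_cong[OF q, of length] that(2) by simp
      then have "(\<rho> ^^ n) (v h) ! (j h + t) = drop (j h) ((\<rho> ^^ n) (v h)) ! t" by simp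
      also have "\<dots> = h x t" unfolding q using that(2) by (simp add: nth_append)
      finally show ?thesis by simp
    qed
    \<comment> \<open>Both images of \<open>x\<close> are read from the same word,
      \<open>g x\<close> starting \<open>k\<close> places further right than
      \<open>f x\<close>.\<close>
    define k where "k = j g - j f"
    have k: "k \<le> s" using vj(2)[OF fg(2)] by (simp add: k_def)
    define T where "T = K * (r + s)"
    have agree: "g x t = f x (t + k)" if "t \<le> T" for t
    proof -
      have "t + k < L" using that k by (simp add: L_def T_def)
      then show ?thesis
        using coord[OF fg(2), of t] coord[OF fg(1), of "t + k"] fg(4,5)
        by (simp add: k_def add.assoc add.commute add.left_commute)
    qed
    \<comment> \<open>Recurrence is applied at scale \<open>r + s\<close>, which is positive and
      bounds \<open>r + k\<close>.\<close>
    have recur: "sublist u (map x [0..<T])" if "u \<in> language \<tau>" "length u \<le> r + k" for u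
      by (rule K[of "r + s"]) (use that n(2) k x in \<open>auto simp: s_def T_def intro: subst_shift_factor\<close>)
    have "\<forall>z\<in>subst_shift \<tau>. g z = (shift ^^ k) (f z)"
      using block_maps_eq_of_long_agreement[of \<tau> "subst_shift \<rho>" f r g x k T] bm r fg x recur agree
      by blast
    then show ?thesis using fg(1,2,3) unfolding shift_related_def by blast
  qed
  then show ?thesis by blast
qed

section \<open>Maximal families of pairwise unrelated maps, and the conclusion\<close>

text \<open>Sets of pairwise unrelated elements have at most \<open>N\<close> members, so one of
  greatest cardinality exists. An element unrelated to all of its members could be added to
  it.\<close>

lemma finite_representatives:
  assumes refl: "\<And>f. R f f" and sym: "\<And>f g. R f g \<Longrightarrow> R g f"
    and bound: "\<And>S. finite S \<Longrightarrow> S \<subseteq> F \<Longrightarrow> N < card S \<Longrightarrow> \<exists>f\<in>S. \<exists>g\<in>S. f \<noteq> g \<and> R f g"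
  shows "\<exists>P. finite P \<and> P \<subseteq> F \<and> (\<forall>f\<in>F. \<exists>g\<in>P. R f g)"
proof -
  define free where "free S \<longleftrightarrow> finite S \<and> S \<subseteq> F \<and> (\<forall>f\<in>S. \<forall>g\<in>S. R f g \<longrightarrow> f = g)" for S
  have freeI: "finite S \<Longrightarrow> S \<subseteq> F \<Longrightarrow> (\<And>f g. f \<in> S \<Longrightarrow> g \<in> S \<Longrightarrow> R f g \<Longrightarrow> f = g) \<Longrightarrow> free S"
    for S unfolding free_def by (intro conjI ballI impI)
  have freeD: "finite S" "S \<subseteq> F" "\<And>f g. f \<in> S \<Longrightarrow> g \<in> S \<Longrightarrow> R f g \<Longrightarrow> f = g" if "free S" for S
    using that unfolding free_def by simp_all
  have "free {}" by (rule freeI) auto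
  moreover have "\<forall>S. free S \<longrightarrow> card S < Suc N"
  proof (intro allI impI)
    fix S assume S: "free S"
    show "card S < Suc N"
    proof (rule ccontr)
      assume "\<not> card S < Suc N"
      then have "N < card S" by simp
      then obtain f g where "f \<in> S" "g \<in> S" "f \<noteq> g" "R f g"
        using bound[OF freeD(1,2)[OF S]] by auto
      then show False using freeD(3)[OF S] by simp
    qed
  qed
  ultimately have "\<exists>P. free P \<and> (\<forall>S. free S \<longrightarrow> card S \<le> card P)"
    by (rule ex_has_greatest_nat)
  then obtain P where P: "free P" and max: "\<And>S. free S \<Longrightarrow> card S \<le> card P" by auto
  have "\<exists>g\<in>P. R f g" if f: "f \<in> F" for f
  proof (rule ccontr)
    assume "\<not> (\<exists>g\<in>P. R f g)"
    then have unrel: "\<not> R f g" if "g \<in> P" for g using that by auto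
    then have "f \<notin> P" using refl by auto
    \<comment> \<open>Symmetry is used here because \<open>f\<close> can be either argument of the
      relation.\<close>
    have "free (insert f P)"
    proof (rule freeI)
      show "g = h" if "g \<in> insert f P" "h \<in> insert f P" "R g h" for g h
        using that unrel sym freeD(3)[OF P] by (elim insertE) auto
    qed (use freeD(1,2)[OF P] f in auto)
    from max[OF this] show False using freeD(1)[OF P] \<open>f \<notin> P\<close> by simp
  qed
  then show ?thesis using freeD(1,2)[OF P] by auto
qed

theorem theorem1:
  fixes \<tau> :: "'a::finite list \<Rightarrow> 'a list"
    and \<rho> :: "'b::finite list \<Rightarrow> 'b list"
    and lam :: real
  assumes "substitution \<tau>" "primitive \<tau>" "aperiodic \<tau>" "balanced_growth \<tau>"
    and "substitution \<rho>" "primitive \<rho>" "aperiodic \<rho>" "balanced_growth \<rho>"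
    and "dominant_eigenvalue (subst_matrix \<tau>) lam"
    and "dominant_eigenvalue (subst_matrix \<rho>) lam"
    and "lam > 1"
  shows "\<exists>P. finite P \<and>
           (\<forall>g\<in>P. block_map (subst_shift \<tau>) (subst_shift \<rho>) g) \<and>
           (\<forall>f. block_map (subst_shift \<tau>) (subst_shift \<rho>) f \<longrightarrow>
              (\<exists>g\<in>P. \<exists>k.
                 (\<forall>x\<in>subst_shift \<tau>. f x = (shift ^^ k) (g x)) \<or>
                 (\<forall>x\<in>subst_shift \<tau>. g x = (shift ^^ k) (f x))))"
proof -
  let ?F = "Collect (block_map (subst_shift \<tau>) (subst_shift \<rho>))"
  have "primitive_substitution \<tau>" "primitive_substitution \<rho>"
    using assms by (auto intro: primitive_substitution.intro)
  from exists_shift_related_pair[OF this]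
  obtain N where "\<forall>S. finite S \<longrightarrow> S \<subseteq> ?F \<longrightarrow> N < card S \<longrightarrow>
      (\<exists>f\<in>S. \<exists>g\<in>S. f \<noteq> g \<and> shift_related (subst_shift \<tau>) f g)" by (rule exE)
  note N = this[rule_format]
  have "\<exists>P. finite P \<and> P \<subseteq> ?F \<and> (\<forall>f\<in>?F. \<exists>g\<in>P. shift_related (subst_shift \<tau>) f g)"
    by (rule finite_representatives[OF shift_related_refl shift_related_sym N])
  then obtain P where P: "finite P" "P \<subseteq> ?F" "\<forall>f\<in>?F. \<exists>g\<in>P. shift_related (subst_shift \<tau>) f g"
    by (elim exE conjE)
  show ?thesis
  proof (intro exI[of _ P] conjI ballI allI impI)
    show "finite P" by (rule P(1))
    show "block_map (subst_shift \<tau>) (subst_shift \<rho>) g" if "g \<in> P" for g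
      using P(2) that by blast
    show "\<exists>g\<in>P. \<exists>k. (\<forall>x\<in>subst_shift \<tau>. f x = (shift ^^ k) (g x)) \<or>
        (\<forall>x\<in>subst_shift \<tau>. g x = (shift ^^ k) (f x))"
      if "block_map (subst_shift \<tau>) (subst_shift \<rho>) f" for f
      unfolding shift_related_def[symmetric] by (rule P(3)[rule_format]) (use that in simp)
  qed
qed

end
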